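(* Let $A \in \mathbb{R}^{m \times n}$ be a matrix, and let $\Sigma := A^\top A$. Suppose that $x = (x_1,\dotsc,x_n)$ is a random vector in $\mathbb{R}^n$ such that, for some $\mu \in \mathbb{R}^n$ and $\sigma \geq 0$, \[ \mathbb{E}\left[ \exp\left(\alpha^\top(x-\mu)\right) \right] \leq \exp\left(\|\alpha\|^2 \sigma^2/2\right) \quad \text{for all } \alpha \in \mathbb{R}^n . \] Then for all $t > 0$, \[ \Pr\left[ \|Ax\|^2 > \sigma^2 \left( \operatorname{tr}(\Sigma) + 2\sqrt{\operatorname{tr}(\Sigma^2)\, t} + 2\|\Sigma\| t \right) + \|A\mu\|^2 \left(1 + 4\left( \frac{\|\Sigma\|^2}{\operatorname{tr}(\Sigma^2)}\, t \right)^{1/2} + \frac{4\|\Sigma\|^2}{\operatorname{tr}(\Sigma^2)}\, t \right)^{1/2} \right] \leq e^{-t} . \]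
   Context: For a vector $v$, $\|v\|$ denotes the Euclidean norm; for a matrix $M$, $\|M\|$ denotes the spectral (operator) norm, and $\operatorname{tr}$ denotes the trace. The coordinates of $x$ are not assumed independent. In the degenerate case $A = 0$ (where $\operatorname{tr}(\Sigma^2)=0$), the term with the factor $\|A\mu\|^2 = 0$ is read as $0$. *)

theory Defs
  imports "HOL-Probability.Probability"
begin

end

theory Submission
  imports Defs
begin

text \<open>
  Let $B$ be an orthonormal eigenbasis of $\Sigma = A^T A$ with eigenvalues $\rho_v$, and let
  $w = \sum_v \sqrt{\rho_v}\, y_v v$ with independent standard normal $y_v$. Averaging over $w$
  linearises the quadratic form: $E_y \exp(l\, w \cdot x) = \exp(l^2 \|Ax\|^2 / 2)$. Exchanging
  the two expectations, the subgaussian hypothesis bounds the expectation over $x$ by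
  $\exp(l\, w \cdot \mu + l^2 \sigma^2 \|w\|^2 / 2)$, whose mean over $y$ is a product of
  one-dimensional Gaussian integrals. Markov's inequality with
  $\gamma = l^2 \sigma^2 / 2 = \sqrt{t/T} / (1 + 2q)$, where $T = tr(\Sigma^2)$ and
  $q = \|\Sigma\| \sqrt{t/T}$, makes the exponent exactly $-t$. The case $\sigma = 0$ follows by
  letting $\sigma$ decrease to $0$.
\<close>

subsection \<open>Spectral theorem for self-adjoint operators\<close>

text \<open>A nonzero \<open>g u\<close> would let the form go negative: moving from
  \<open>u\<close> along \<open>w = g u\<close> changes it by a first-order term proportional to
  \<open>w \<bullet> w\<close>, which beats the second-order term for small negative
  \<open>s\<close>. This replaces a derivative argument at a maximiser.\<close>

lemma psd_form_zero_imp_kernel: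
  fixes g :: "'a::real_inner \<Rightarrow> 'a"
  assumes lin: "linear g" and sym: "\<And>x y. g x \<bullet> y = x \<bullet> g y"
    and S: "subspace S" and inv: "\<And>x. x \<in> S \<Longrightarrow> g x \<in> S"
    and psd: "\<And>x. x \<in> S \<Longrightarrow> 0 \<le> x \<bullet> g x"
    and u: "u \<in> S" "u \<bullet> g u = 0"
  shows "g u = 0"
proof -
  define w where "w = g u"
  have "w \<in> S" using inv u w_def by simp
  define q where "q = w \<bullet> g w"
  have q0: "0 \<le> q" using psd[OF \<open>w \<in> S\<close>] by (simp add: q_def)
  \<comment> \<open>The form at \<open>u + s *\<^sub>R w\<close>, expanded in \<open>s\<close>; its
    constant term \<open>u \<bullet> g u\<close> vanishes.\<close>
  have ineq: "0 \<le> s * (2 * (w \<bullet> w)) + s\<^sup>2 * q" for s :: real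
  proof -
    have "u + s *\<^sub>R w \<in> S" using u \<open>w \<in> S\<close> S by (simp add: subspace_add subspace_scale)
    from psd[OF this] have "0 \<le> (u + s *\<^sub>R w) \<bullet> (g u + s *\<^sub>R g w)"
      by (simp add: linear_add[OF lin] linear_scale[OF lin])
    also have "\<dots> = u \<bullet> g u + s * (u \<bullet> g w) + s * (w \<bullet> g u) + s\<^sup>2 * (w \<bullet> g w)"
      by (simp add: inner_simps algebra_simps power2_eq_square)
    also have "u \<bullet> g w = w \<bullet> w" using sym[of u w] by (simp add: w_def)
    finally show ?thesis using u by (simp add: q_def w_def algebra_simps)
  qed
  \<comment> \<open>The minimiser would be \<open>- (w \<bullet> w) / q\<close>; the shift avoids division by zero when \<open>q = 0\<close>.\<close>
  define s where "s = - (w \<bullet> w) / (q + 1)"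
  have "s * (2 * (w \<bullet> w)) + s\<^sup>2 * q = - (w \<bullet> w)\<^sup>2 * ((q + 2) / (q + 1)\<^sup>2)"
  proof -
    have "q + 1 \<noteq> 0" using q0 by simp
    then show ?thesis unfolding s_def
      by (simp add: divide_simps power2_eq_square) (simp add: algebra_simps)
  qed
  then have "(w \<bullet> w)\<^sup>2 * ((q + 2) / (q + 1)\<^sup>2) \<le> 0" using ineq[of s] by simp
  moreover have "(q + 2) / (q + 1)\<^sup>2 > 0" using q0 by simp
  ultimately have "(w \<bullet> w)\<^sup>2 \<le> 0" by (meson mult_pos_pos not_le)
  then show ?thesis by (simp add: w_def)
qed

text \<open>The quadratic form of \<open>f\<close> attains a maximum \<open>m\<close> on the compact
  unit sphere of \<open>S\<close>, at some \<open>u\<close>. Then \<open>m *\<^sub>R x - f x\<close>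
  has a form that is nonnegative on \<open>S\<close> and zero at \<open>u\<close>, so it kills
  \<open>u\<close>.\<close>

lemma selfadjoint_eigenvector_exists:
  fixes f :: "'a::euclidean_space \<Rightarrow> 'a"
  assumes lin: "linear f" and sym: "\<And>x y. f x \<bullet> y = x \<bullet> f y"
    and S: "subspace S" and inv: "\<And>x. x \<in> S \<Longrightarrow> f x \<in> S" and "S \<noteq> {0}"
  obtains u where "u \<in> S" "norm u = 1" "f u = (u \<bullet> f u) *\<^sub>R u"
proof -
  obtain x where x: "x \<in> S" "x \<noteq> 0" using \<open>S \<noteq> {0}\<close> subspace_0[OF S] by blast
  have "compact (sphere 0 1 \<inter> S)"
    by (simp add: closed_subspace[OF S] compact_Int_closed)
  moreover have "x /\<^sub>R norm x \<in> sphere 0 1 \<inter> S" using x S by (simp add: subspace_scale)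
  moreover have "continuous_on (sphere 0 1 \<inter> S) (\<lambda>x. x \<bullet> f x)"
    by (intro continuous_intros linear_continuous_on lin[unfolded linear_conv_bounded_linear])
  ultimately obtain u where u: "u \<in> sphere 0 1 \<inter> S"
    and max: "\<And>y. y \<in> sphere 0 1 \<inter> S \<Longrightarrow> y \<bullet> f y \<le> u \<bullet> f u"
    using continuous_attains_sup[of "sphere 0 1 \<inter> S" "\<lambda>x. x \<bullet> f x"] by blast
  define m where "m = u \<bullet> f u"
  have uu: "u \<bullet> u = 1" using u by (simp add: norm_eq_1)
  have "m *\<^sub>R u - f u = 0"
  proof (rule psd_form_zero_imp_kernel[where S = S and g = "\<lambda>x. m *\<^sub>R x - f x"])
    show "linear (\<lambda>x. m *\<^sub>R x - f x)"
      by (intro linear_compose_sub lin linear_compose_scale_right linear_id[unfolded id_def])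
    show "0 \<le> y \<bullet> (m *\<^sub>R y - f y)" if "y \<in> S" for y
    proof (cases "y = 0")
      case False
      then have "y /\<^sub>R norm y \<in> sphere 0 1 \<inter> S" using that S by (simp add: subspace_scale)
      from max[OF this] have "(y \<bullet> f y) / (norm y)\<^sup>2 \<le> m"
        by (simp add: linear_scale[OF lin] m_def power2_eq_square divide_simps)
      then have "y \<bullet> f y \<le> m * (y \<bullet> y)"
        using False by (simp add: divide_le_eq power2_norm_eq_inner)
      then show ?thesis by (simp add: inner_simps)
    qed simp
  qed (use S u inv sym uu in \<open>auto simp: inner_simps subspace_diff subspace_scale m_def\<close>)
  then show ?thesis using that[of u] u by (simp add: m_def)
qed

text \<open>An orthonormal set of eigenvectors of greatest cardinality must span: otherwise its
  orthogonal complement is a nonzero invariant subspace and supplies one more eigenvector.\<close>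

theorem selfadjoint_orthonormal_eigenbasis:
  fixes f :: "'a::euclidean_space \<Rightarrow> 'a"
  assumes lin: "linear f" and sym: "\<And>x y. f x \<bullet> y = x \<bullet> f y"
  obtains B where "finite B" "pairwise orthogonal B" "\<And>v. v \<in> B \<Longrightarrow> norm v = 1"
    "span B = UNIV" "\<And>v. v \<in> B \<Longrightarrow> f v = (v \<bullet> f v) *\<^sub>R v"
proof -
  define P where "P B \<longleftrightarrow> pairwise orthogonal B \<and> (\<forall>v\<in>B. norm v = 1 \<and> f v = (v \<bullet> f v) *\<^sub>R v)"
    for B
  have P_ind: "independent B" if "P B" for B
    using that by (intro pairwise_orthogonal_independent) (auto simp: P_def)
  have "P {}" by (simp add: P_def)
  \<comment> \<open>Orthonormal sets are independent, so the dimension bounds their size and a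
    largest one exists.\<close>
  moreover have "\<forall>B. P B \<longrightarrow> card B < Suc (DIM('a))"
    using independent_bound P_ind by (metis less_Suc_eq_le)
  ultimately obtain B where B: "P B" and max: "\<And>C. P C \<Longrightarrow> card C \<le> card B"
    using ex_has_greatest_nat[of P "{}" card "Suc (DIM('a))"] by blast
  have "finite B" using P_ind[OF B] independent_imp_finite by blast
  have "span B = UNIV"
  proof (rule ccontr)
    assume "span B \<noteq> UNIV"
    then have "dim B < DIM('a)" by (metis dim_eq_full dim_subset_UNIV le_neq_implies_less)
    then obtain z where z: "z \<noteq> 0" "\<And>y. y \<in> span B \<Longrightarrow> orthogonal z y"
      using orthogonal_to_subspace_exists by blast
    define S where "S = {y. \<forall>v\<in>B. orthogonal v y}"
    have "z \<in> S" using z(2) by (auto simp: S_def orthogonal_commute span_base)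
    then have "S \<noteq> {0}" using z(1) by auto
    moreover have "subspace S" unfolding S_def by (rule subspace_orthogonal_to_vectors)
    \<comment> \<open>Self-adjointness moves \<open>f\<close> onto the eigenvector \<open>v\<close>,
      where it acts as a scalar, so orthogonality to \<open>v\<close> survives.\<close>
    moreover have "f y \<in> S" if "y \<in> S" for y
    proof -
      have "v \<bullet> f y = 0" if "v \<in> B" for v
      proof -
        have "v \<bullet> f y = f v \<bullet> y" using sym by simp
        also have "\<dots> = (v \<bullet> f v) * (v \<bullet> y)"
          using B \<open>v \<in> B\<close> unfolding P_def by (metis inner_scaleR_left)
        finally show ?thesis using \<open>y \<in> S\<close> \<open>v \<in> B\<close> by (simp add: S_def orthogonal_def)
      qed
      then show ?thesis by (simp add: S_def orthogonal_def)
    qed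
    ultimately obtain u where u: "u \<in> S" "norm u = 1" "f u = (u \<bullet> f u) *\<^sub>R u"
      using selfadjoint_eigenvector_exists[OF lin sym] by metis
    have "u \<notin> B" using u by (auto simp: S_def orthogonal_def)
    have "P (insert u B)"
      using B u by (auto simp: P_def pairwise_insert S_def orthogonal_commute)
    from max[OF this] show False using \<open>u \<notin> B\<close> \<open>finite B\<close> by simp
  qed
  then show ?thesis using that[of B] B \<open>finite B\<close> by (auto simp: P_def)
qed

section \<open>Coordinates and traces in an orthonormal basis\<close>

text \<open>The residual \<open>?d\<close> is orthogonal to each basis vector, hence to the whole
  span, hence to itself.\<close>

lemma orthonormal_basis_expansion:
  fixes B :: "'a::real_inner set"
  assumes "finite B" "pairwise orthogonal B" "\<And>v. v \<in> B \<Longrightarrow> norm v = 1" "span B = UNIV"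
  shows "(\<Sum>v\<in>B. (x \<bullet> v) *\<^sub>R v) = x"
proof -
  let ?d = "x - (\<Sum>v\<in>B. (x \<bullet> v) *\<^sub>R v)"
  have "orthogonal ?d v" if "v \<in> B" for v
  proof -
    have "w \<bullet> v = (if w = v then 1 else 0)" if "w \<in> B" for w
      using assms(2,3) that \<open>v \<in> B\<close> by (auto simp: pairwise_def orthogonal_def norm_eq_1)
    then have "(\<Sum>w\<in>B. (x \<bullet> w) *\<^sub>R w) \<bullet> v = (\<Sum>w\<in>B. if w = v then x \<bullet> w else 0)"
      by (auto simp: inner_sum_left intro!: sum.cong)
    then show ?thesis using assms(1) that by (simp add: orthogonal_def inner_diff_left)
  qed
  then have "orthogonal ?d ?d" by (rule orthogonal_to_span[where S = B, rotated]) (auto simp: assms(4))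
  then show ?thesis by (simp add: orthogonal_self)
qed

lemma orthonormal_basis_inner:
  fixes B :: "'a::real_inner set"
  assumes "finite B" "pairwise orthogonal B" "\<And>v. v \<in> B \<Longrightarrow> norm v = 1" "span B = UNIV"
  shows "x \<bullet> y = (\<Sum>v\<in>B. (x \<bullet> v) * (y \<bullet> v))"
proof -
  have "x \<bullet> y = (\<Sum>v\<in>B. (x \<bullet> v) *\<^sub>R v) \<bullet> y"
    using orthonormal_basis_expansion[OF assms] by simp
  also have "\<dots> = (\<Sum>v\<in>B. (x \<bullet> v) * (y \<bullet> v))"
    by (simp add: inner_sum_left inner_commute[of y])
  finally show ?thesis .
qed

text \<open>Each diagonal entry is the inner product of an axis vector with a row; expanding it by
  Parseval in \<open>B\<close> and exchanging the sums gives the forms at the basis vectors.\<close>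

lemma trace_orthonormal_basis:
  fixes S :: "real ^ 'n ^ 'n" and B :: "(real ^ 'n) set"
  assumes "finite B" "pairwise orthogonal B" "\<And>v. v \<in> B \<Longrightarrow> norm v = 1" "span B = UNIV"
  shows "trace S = (\<Sum>v\<in>B. v \<bullet> (S *v v))"
proof -
  have "(\<Sum>v\<in>B. v \<bullet> (S *v v)) = (\<Sum>v\<in>B. \<Sum>i\<in>UNIV. v $ i * (row i S \<bullet> v))"
    by (simp add: inner_vec_def matrix_vector_mult_def row_def)
  also have "\<dots> = (\<Sum>i\<in>UNIV. \<Sum>v\<in>B. (axis i 1 \<bullet> v) * (row i S \<bullet> v))"
    by (subst sum.swap) (simp add: inner_axis inner_commute)
  also have "\<dots> = (\<Sum>i\<in>UNIV. axis i 1 \<bullet> row i S)"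
    by (intro sum.cong refl orthonormal_basis_inner[OF assms, symmetric])
  also have "\<dots> = trace S" by (simp add: trace_def row_def inner_axis')
  finally show ?thesis by simp
qed

section \<open>Spectral data of a Gram matrix\<close>

lemma norm_matrix_vector_sq:
  fixes A :: "real ^ 'n ^ 'm"
  shows "(norm (A *v x))\<^sup>2 = x \<bullet> (transpose A ** A *v x)"
  by (metis dot_lmul_matrix matrix_vector_mul_assoc power2_norm_eq_inner
      vector_transpose_matrix)

text \<open>This turns all the matrix quantities of the tail bound into sums over eigenvalues, so
  that the probabilistic part can work with \<open>B\<close> and \<open>\<rho>\<close>
  alone.\<close>

lemma gram_matrix_spectral:
  fixes A :: "real ^ 'n ^ 'm"
  defines "S \<equiv> transpose A ** A"
  obtains B :: "(real ^ 'n) set" and \<rho> :: "real ^ 'n \<Rightarrow> real"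
  where "finite B" "pairwise orthogonal B" "\<And>v. v \<in> B \<Longrightarrow> norm v = 1"
    "\<And>v. v \<in> B \<Longrightarrow> 0 \<le> \<rho> v" "\<And>v. v \<in> B \<Longrightarrow> \<rho> v \<le> onorm ((*v) S)"
    "trace S = (\<Sum>v\<in>B. \<rho> v)" "trace (S ** S) = (\<Sum>v\<in>B. (\<rho> v)\<^sup>2)"
    "\<And>x. (norm (A *v x))\<^sup>2 = (\<Sum>v\<in>B. \<rho> v * (v \<bullet> x)\<^sup>2)"
proof -
  have sym: "(S *v x) \<bullet> y = x \<bullet> (S *v y)" for x y
    unfolding S_def by (metis dot_lmul_matrix matrix_transpose_mul transpose_transpose
        vector_transpose_matrix)
  obtain B where B: "finite B" "pairwise orthogonal B" "\<And>v. v \<in> B \<Longrightarrow> norm v = 1"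
    "span B = UNIV" and eig: "\<And>v. v \<in> B \<Longrightarrow> S *v v = (v \<bullet> (S *v v)) *\<^sub>R v"
    using selfadjoint_orthonormal_eigenbasis[OF matrix_vector_mul_linear sym] by metis
  define \<rho> where "\<rho> v = v \<bullet> (S *v v)" for v
  have Sv: "S *v v = \<rho> v *\<^sub>R v" if "v \<in> B" for v using eig[OF that] by (simp add: \<rho>_def)
  show ?thesis
  proof (rule that[OF B(1-3)])
    show "0 \<le> \<rho> v" if "v \<in> B" for v
      by (simp add: \<rho>_def S_def flip: norm_matrix_vector_sq)
    show "\<rho> v \<le> onorm ((*v) S)" if "v \<in> B" for v
    proof -
      have "\<rho> v \<le> norm (S *v v)" using Sv[OF that] B(3)[OF that] by simp
      also have "\<dots> \<le> onorm ((*v) S) * norm v"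
        by (rule onorm) (rule matrix_vector_mul_bounded_linear)
      finally show ?thesis using B(3)[OF that] by simp
    qed
    show "trace S = (\<Sum>v\<in>B. \<rho> v)" by (simp add: trace_orthonormal_basis[OF B] \<rho>_def)
    have "v \<bullet> (S ** S *v v) = (\<rho> v)\<^sup>2" if "v \<in> B" for v
    proof -
      have "v \<bullet> (S ** S *v v) = (S *v v) \<bullet> (S *v v)"
        by (simp add: sym matrix_vector_mul_assoc)
      then show ?thesis using Sv[OF that] B(3)[OF that]
        by (simp add: power2_eq_square norm_eq_1)
    qed
    then show "trace (S ** S) = (\<Sum>v\<in>B. (\<rho> v)\<^sup>2)" by (simp add: trace_orthonormal_basis[OF B])
    show "(norm (A *v x))\<^sup>2 = (\<Sum>v\<in>B. \<rho> v * (v \<bullet> x)\<^sup>2)" for x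
    proof -
      \<comment> \<open>Parseval for \<open>x\<close> and \<open>S *v x\<close>; symmetry then moves
        \<open>S\<close> onto the eigenvector \<open>v\<close>.\<close>
      have "(norm (A *v x))\<^sup>2 = (\<Sum>v\<in>B. (x \<bullet> v) * ((S *v x) \<bullet> v))"
        unfolding norm_matrix_vector_sq S_def[symmetric] by (rule orthonormal_basis_inner[OF B])
      also have "\<dots> = (\<Sum>v\<in>B. \<rho> v * (v \<bullet> x)\<^sup>2)"
        by (intro sum.cong)
          (simp_all add: sym Sv inner_commute[of x] power2_eq_square mult.left_commute)
      finally show ?thesis .
    qed
  qed
qed

subsection \<open>Gaussian linearisation\<close>

text \<open>Completing the square makes the integrand a constant times another normal density, whose
  integral is 1. The condition on \<open>b\<close> keeps the coefficient of the square
  negative.\<close>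

lemma nn_integral_exp_quadratic_std_normal:
  fixes a b :: real
  assumes "b < 1/2"
  shows "(\<integral>\<^sup>+ y. ennreal (exp (a * y + b * y\<^sup>2)) \<partial>density lborel std_normal_density)
    = ennreal (exp (a\<^sup>2 / (2 * (1 - 2 * b))) / sqrt (1 - 2 * b))"
proof -
  \<comment> \<open>Standard deviation of the tilted normal law; its mean is
    \<open>a * s\<^sup>2\<close>.\<close>
  define s where "s = 1 / sqrt (1 - 2 * b)"
  have s: "0 < s" "s\<^sup>2 * (1 - 2 * b) = 1" using assms by (auto simp: s_def power_divide)
  have b: "b = 1/2 - 1 / (2 * s\<^sup>2)" using s by (simp add: field_simps)
  have "std_normal_density y * exp (a * y + b * y\<^sup>2)
      = s * exp (a\<^sup>2 * s\<^sup>2 / 2) * normal_density (a * s\<^sup>2) s y" for y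
  proof -
    have "- y\<^sup>2 / 2 + (a * y + b * y\<^sup>2) = a\<^sup>2 * s\<^sup>2 / 2 + - (y - a * s\<^sup>2)\<^sup>2 / (2 * s\<^sup>2)"
      using s(1) unfolding b by (simp add: field_simps power2_eq_square)
    then have "exp (- y\<^sup>2 / 2) * exp (a * y + b * y\<^sup>2)
        = exp (a\<^sup>2 * s\<^sup>2 / 2) * exp (- (y - a * s\<^sup>2)\<^sup>2 / (2 * s\<^sup>2))"
      by (simp flip: exp_add)
    then show ?thesis using s(1)
      by (simp add: normal_density_def real_sqrt_mult)
  qed
  then have "(\<integral>\<^sup>+ y. ennreal (exp (a * y + b * y\<^sup>2)) \<partial>density lborel std_normal_density)
      = (\<integral>\<^sup>+ y. ennreal (s * exp (a\<^sup>2 * s\<^sup>2 / 2)) * ennreal (normal_density (a * s\<^sup>2) s y) \<partial>lborel)"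
    using s(1) by (subst nn_integral_density) (auto simp: ennreal_mult[symmetric])
  also have "\<dots> = ennreal (s * exp (a\<^sup>2 * s\<^sup>2 / 2)) * (\<integral>\<^sup>+ y. ennreal (normal_density (a * s\<^sup>2) s y) \<partial>lborel)"
    by (rule nn_integral_cmult) simp
  also have "(\<integral>\<^sup>+ y. ennreal (normal_density (a * s\<^sup>2) s y) \<partial>lborel) = 1"
    using s(1) by (subst nn_integral_eq_integral) auto
  also have "a\<^sup>2 * s\<^sup>2 / 2 = a\<^sup>2 / (2 * (1 - 2 * b))"
    using assms by (simp add: s_def power_divide)
  finally show ?thesis by (simp add: s_def)
qed

text \<open>After taking logarithms, the difference \<open>?h\<close> of the two sides vanishes at 0
  and has derivative \<open>2 * y\<^sup>2 / (1 - 2 * y)\<^sup>2\<close>, which is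
  nonnegative.\<close>

lemma inverse_sqrt_le_exp:
  fixes b :: real
  assumes "0 \<le> b" "b < 1/2"
  shows "1 / sqrt (1 - 2 * b) \<le> exp (b + b\<^sup>2 / (1 - 2 * b))"
proof -
  let ?h = "\<lambda>b::real. b + b\<^sup>2 / (1 - 2 * b) + ln (1 - 2 * b) / 2"
  have "?h 0 \<le> ?h b"
  proof (rule DERIV_nonneg_imp_nondecreasing[OF assms(1)])
    fix y :: real assume y: "0 \<le> y" "y \<le> b"
    then have y': "0 < 1 - 2 * y" using assms by simp
    \<comment> \<open>Differentiating \<open>ln (1 - 2 * y) / 2\<close> as a quotient leaves the
      unreduced fraction.\<close>
    have "4 / (4 - 8 * y) = 1 / (1 - 2 * y)" using y' by (simp add: divide_simps)
    then have "(?h has_real_derivative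
        1 + (2 * y * (1 - 2 * y) + 2 * y\<^sup>2) / (1 - 2 * y)\<^sup>2 - 1 / (1 - 2 * y)) (at y)"
      using y' by (auto intro!: derivative_eq_intros simp: power2_eq_square)
    moreover have "1 + (2 * y * (1 - 2 * y) + 2 * y\<^sup>2) / (1 - 2 * y)\<^sup>2 - 1 / (1 - 2 * y)
        = 2 * y\<^sup>2 / (1 - 2 * y)\<^sup>2"
      using y' by (simp add: divide_simps power2_eq_square) (simp add: algebra_simps)
    ultimately have "(?h has_real_derivative 2 * y\<^sup>2 / (1 - 2 * y)\<^sup>2) (at y)" by simp
    then show "\<exists>z. (?h has_real_derivative z) (at y) \<and> 0 \<le> z" by (intro exI conjI) auto
  qed
  then have "- (ln (1 - 2 * b) / 2) \<le> b + b\<^sup>2 / (1 - 2 * b)" by simp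
  moreover have "1 / sqrt (1 - 2 * b) = exp (- (ln (1 - 2 * b) / 2))"
    using assms by (simp add: exp_minus inverse_eq_divide flip: ln_sqrt)
  ultimately show ?thesis by simp
qed


text \<open>The exchange of expectations, with exact Gaussian integrals. Nonnegative integrals let
  Tonelli apply without prior integrability, and \<open>b\<close> is precisely the convergence
  condition of each one-dimensional factor.\<close>

lemma subgaussian_quadratic_form_mgf:
  fixes x :: "'a \<Rightarrow> 'b::euclidean_space" and B :: "'b set" and \<rho> :: "'b \<Rightarrow> real"
  assumes "prob_space M" and x[measurable]: "x \<in> borel_measurable M"
    and sub: "\<And>\<alpha>. (\<integral>\<^sup>+ \<omega>. ennreal (exp (\<alpha> \<bullet> (x \<omega> - \<mu>))) \<partial>M)
                 \<le> ennreal (exp ((norm \<alpha>)\<^sup>2 * \<sigma>\<^sup>2 / 2))"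
    and B: "finite B" "pairwise orthogonal B" "\<And>v. v \<in> B \<Longrightarrow> norm v = 1"
    and \<rho>: "\<And>v. v \<in> B \<Longrightarrow> 0 \<le> \<rho> v"
    and b: "\<And>v. v \<in> B \<Longrightarrow> l\<^sup>2 * \<sigma>\<^sup>2 * \<rho> v < 1"
  shows "(\<integral>\<^sup>+ \<omega>. ennreal (exp (l\<^sup>2 / 2 * (\<Sum>v\<in>B. \<rho> v * (v \<bullet> x \<omega>)\<^sup>2))) \<partial>M)
    \<le> ennreal (\<Prod>v\<in>B. exp (l\<^sup>2 * \<rho> v * (v \<bullet> \<mu>)\<^sup>2 / (2 * (1 - l\<^sup>2 * \<sigma>\<^sup>2 * \<rho> v)))
                    / sqrt (1 - l\<^sup>2 * \<sigma>\<^sup>2 * \<rho> v))"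
proof -
  interpret prob_space M by fact
  define N :: "real measure" where "N = density lborel std_normal_density"
  have setsN[measurable_cong]: "sets N = sets borel" by (simp add: N_def)
  interpret N: prob_space N unfolding N_def by (rule prob_space_normal_density) simp
  interpret P: product_prob_space "\<lambda>_::'b. N" B ..
  define G where "G = PiM B (\<lambda>_. N)"
  interpret G: prob_space G unfolding G_def by (intro prob_space_PiM N.prob_space_axioms)
  interpret MG: pair_sigma_finite M G ..
  define w where "w y = (\<Sum>v\<in>B. (sqrt (\<rho> v) * y v) *\<^sub>R v)" for y :: "'b \<Rightarrow> real"
  have w[measurable]: "w \<in> borel_measurable G"
    unfolding w_def[abs_def] G_def by measurable
  have w_inner: "l *\<^sub>R w y \<bullet> z = (\<Sum>v\<in>B. (l * sqrt (\<rho> v) * (v \<bullet> z)) * y v)" for y z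
    by (simp add: w_def inner_sum_left sum_distrib_left mult_ac)
  \<comment> \<open>Orthonormality removes the cross terms, so the subgaussian bound also factorises
    over \<open>B\<close>.\<close>
  have "w y \<bullet> w y = (\<Sum>v\<in>B. \<rho> v * (y v)\<^sup>2)" for y
  proof -
    have "w y \<bullet> v = sqrt (\<rho> v) * y v" if "v \<in> B" for v
    proof -
      have "u \<bullet> v = (if u = v then 1 else 0)" if "u \<in> B" for u
        using B that \<open>v \<in> B\<close> by (auto simp: pairwise_def orthogonal_def norm_eq_1)
      then have "w y \<bullet> v = (\<Sum>u\<in>B. if u = v then sqrt (\<rho> u) * y u else 0)"
        by (auto simp: w_def inner_sum_left intro!: sum.cong)
      then show ?thesis using B that by simp
    qed
    then have "w y \<bullet> w y = (\<Sum>v\<in>B. (sqrt (\<rho> v) * y v) * (sqrt (\<rho> v) * y v))"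
      by (subst (2) w_def) (simp add: inner_sum_right)
    also have "\<dots> = (\<Sum>v\<in>B. \<rho> v * (y v)\<^sup>2)"
      using \<rho> by (intro sum.cong) (auto simp: power2_eq_square)
    finally show ?thesis .
  qed
  then have w_norm: "(norm (l *\<^sub>R w y))\<^sup>2 * \<sigma>\<^sup>2 / 2 = (\<Sum>v\<in>B. (l\<^sup>2 * \<sigma>\<^sup>2 * \<rho> v / 2) * (y v)\<^sup>2)" for y
    by (simp add: power_mult_distrib power2_norm_eq_inner sum_distrib_left sum_divide_distrib mult_ac)
  \<comment> \<open>Independence of the coordinates under \<open>G\<close>. It serves twice: with
    \<open>\<beta> = 0\<close> to linearise the form, and with the quadratic term of the subgaussian
    bound at the end.\<close>
  have prod: "(\<integral>\<^sup>+ y. ennreal (exp (\<Sum>v\<in>B. \<alpha> v * y v + \<beta> v * (y v)\<^sup>2)) \<partial>G)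
      = ennreal (\<Prod>v\<in>B. exp ((\<alpha> v)\<^sup>2 / (2 * (1 - 2 * \<beta> v))) / sqrt (1 - 2 * \<beta> v))"
    if "\<And>v. v \<in> B \<Longrightarrow> \<beta> v < 1/2" for \<alpha> \<beta> :: "'b \<Rightarrow> real"
  proof -
    have "(\<integral>\<^sup>+ y. ennreal (exp (\<Sum>v\<in>B. \<alpha> v * y v + \<beta> v * (y v)\<^sup>2)) \<partial>G)
        = (\<integral>\<^sup>+ y. (\<Prod>v\<in>B. ennreal (exp (\<alpha> v * y v + \<beta> v * (y v)\<^sup>2))) \<partial>G)"
      using B by (simp add: exp_sum prod_ennreal)
    also have "\<dots> = (\<Prod>v\<in>B. \<integral>\<^sup>+ y. ennreal (exp (\<alpha> v * y + \<beta> v * y\<^sup>2)) \<partial>N)"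
      unfolding G_def using B by (intro P.product_nn_integral_prod) auto
    also have "\<dots> = (\<Prod>v\<in>B. ennreal (exp ((\<alpha> v)\<^sup>2 / (2 * (1 - 2 * \<beta> v))) / sqrt (1 - 2 * \<beta> v)))"
      unfolding N_def using that by (intro prod.cong nn_integral_exp_quadratic_std_normal) auto
    also have "\<dots> = ennreal (\<Prod>v\<in>B. exp ((\<alpha> v)\<^sup>2 / (2 * (1 - 2 * \<beta> v))) / sqrt (1 - 2 * \<beta> v))"
      using that by (intro prod_ennreal divide_nonneg_nonneg) (auto dest!: that)
    finally show ?thesis .
  qed
  have "ennreal (exp (l\<^sup>2 / 2 * (\<Sum>v\<in>B. \<rho> v * (v \<bullet> x \<omega>)\<^sup>2)))
      = (\<integral>\<^sup>+ y. ennreal (exp (l *\<^sub>R w y \<bullet> x \<omega>)) \<partial>G)" for \<omega>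
  proof -
    have "(\<integral>\<^sup>+ y. ennreal (exp (l *\<^sub>R w y \<bullet> x \<omega>)) \<partial>G)
        = ennreal (\<Prod>v\<in>B. exp ((l * sqrt (\<rho> v) * (v \<bullet> x \<omega>))\<^sup>2 / 2))"
      unfolding w_inner
      using prod[of "\<lambda>_. 0" "\<lambda>v. l * sqrt (\<rho> v) * (v \<bullet> x \<omega>)"] by simp
    also have "(\<Prod>v\<in>B. exp ((l * sqrt (\<rho> v) * (v \<bullet> x \<omega>))\<^sup>2 / 2))
        = (\<Prod>v\<in>B. exp (l\<^sup>2 / 2 * (\<rho> v * (v \<bullet> x \<omega>)\<^sup>2)))"
      using \<rho> by (intro prod.cong) (auto simp: power_mult_distrib)
    finally show ?thesis using B by (simp add: exp_sum sum_distrib_left)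
  qed
  then have "(\<integral>\<^sup>+ \<omega>. ennreal (exp (l\<^sup>2 / 2 * (\<Sum>v\<in>B. \<rho> v * (v \<bullet> x \<omega>)\<^sup>2))) \<partial>M)
      = (\<integral>\<^sup>+ \<omega>. \<integral>\<^sup>+ y. ennreal (exp (l *\<^sub>R w y \<bullet> x \<omega>)) \<partial>G \<partial>M)" by simp
  also have "\<dots> = (\<integral>\<^sup>+ y. \<integral>\<^sup>+ \<omega>. ennreal (exp (l *\<^sub>R w y \<bullet> x \<omega>)) \<partial>M \<partial>G)"
    by (rule MG.Fubini'[symmetric]) measurable
  also have "\<dots> \<le> (\<integral>\<^sup>+ y. ennreal (exp (\<Sum>v\<in>B. (l * sqrt (\<rho> v) * (v \<bullet> \<mu>)) * y v
      + (l\<^sup>2 * \<sigma>\<^sup>2 * \<rho> v / 2) * (y v)\<^sup>2)) \<partial>G)"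
  \<comment> \<open>For fixed \<open>y\<close> the hypothesis is applied at
    \<open>\<alpha> = l *\<^sub>R w y\<close>, after splitting off the deterministic factor at
    \<open>\<mu>\<close>.\<close>
  proof (rule nn_integral_mono)
    fix y
    have "exp (l *\<^sub>R w y \<bullet> x \<omega>) = exp (l *\<^sub>R w y \<bullet> \<mu>) * exp (l *\<^sub>R w y \<bullet> (x \<omega> - \<mu>))" for \<omega>
      by (simp add: inner_diff_right flip: exp_add)
    then have "(\<integral>\<^sup>+ \<omega>. ennreal (exp (l *\<^sub>R w y \<bullet> x \<omega>)) \<partial>M)
        = ennreal (exp (l *\<^sub>R w y \<bullet> \<mu>)) * (\<integral>\<^sup>+ \<omega>. ennreal (exp (l *\<^sub>R w y \<bullet> (x \<omega> - \<mu>))) \<partial>M)"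
      by (simp add: ennreal_mult nn_integral_cmult)
    also have "\<dots> \<le> ennreal (exp (l *\<^sub>R w y \<bullet> \<mu>)) * ennreal (exp ((norm (l *\<^sub>R w y))\<^sup>2 * \<sigma>\<^sup>2 / 2))"
      by (intro mult_left_mono sub) simp
    also have "\<dots> = ennreal (exp (\<Sum>v\<in>B. (l * sqrt (\<rho> v) * (v \<bullet> \<mu>)) * y v
      + (l\<^sup>2 * \<sigma>\<^sup>2 * \<rho> v / 2) * (y v)\<^sup>2))"
      unfolding w_norm w_inner by (simp add: sum.distrib exp_add ennreal_mult)
    finally show "(\<integral>\<^sup>+ \<omega>. ennreal (exp (l *\<^sub>R w y \<bullet> x \<omega>)) \<partial>M) \<le> \<dots>" .
  qed
  also have "\<dots> = ennreal (\<Prod>v\<in>B. exp ((l * sqrt (\<rho> v) * (v \<bullet> \<mu>))\<^sup>2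
      / (2 * (1 - 2 * (l\<^sup>2 * \<sigma>\<^sup>2 * \<rho> v / 2)))) / sqrt (1 - 2 * (l\<^sup>2 * \<sigma>\<^sup>2 * \<rho> v / 2)))"
    using b by (intro prod) simp
  also have "\<dots> = ennreal (\<Prod>v\<in>B. exp (l\<^sup>2 * \<rho> v * (v \<bullet> \<mu>)\<^sup>2 / (2 * (1 - l\<^sup>2 * \<sigma>\<^sup>2 * \<rho> v)))
                    / sqrt (1 - l\<^sup>2 * \<sigma>\<^sup>2 * \<rho> v))"
    using \<rho> by (intro arg_cong[where f = ennreal] prod.cong) (auto simp: power_mult_distrib)
  finally show ?thesis .
qed

text \<open>Each inverse square root is bounded by an exponential, and each denominator
  \<open>1 - 2 * \<gamma> * \<rho> v\<close> by the common smaller one with \<open>r\<close>. The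
  exponents then add up to sums of the eigenvalues and of their squares.\<close>

lemma subgaussian_quadratic_form_mgf_le:
  fixes x :: "'a \<Rightarrow> 'b::euclidean_space" and B :: "'b set" and \<rho> :: "'b \<Rightarrow> real"
  assumes "prob_space M" and x[measurable]: "x \<in> borel_measurable M"
    and sub: "\<And>\<alpha>. (\<integral>\<^sup>+ \<omega>. ennreal (exp (\<alpha> \<bullet> (x \<omega> - \<mu>))) \<partial>M)
                 \<le> ennreal (exp ((norm \<alpha>)\<^sup>2 * \<sigma>\<^sup>2 / 2))"
    and B: "finite B" "pairwise orthogonal B" "\<And>v. v \<in> B \<Longrightarrow> norm v = 1"
    and \<rho>: "\<And>v. v \<in> B \<Longrightarrow> 0 \<le> \<rho> v" "\<And>v. v \<in> B \<Longrightarrow> \<rho> v \<le> r"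
    and \<sigma>: "0 < \<sigma>" and \<gamma>: "0 < \<gamma>" "2 * \<gamma> * r < 1"
  shows "(\<integral>\<^sup>+ \<omega>. ennreal (exp (\<gamma> / \<sigma>\<^sup>2 * (\<Sum>v\<in>B. \<rho> v * (v \<bullet> x \<omega>)\<^sup>2))) \<partial>M)
    \<le> ennreal (exp (\<gamma> * (\<Sum>v\<in>B. \<rho> v) + (\<gamma>\<^sup>2 * (\<Sum>v\<in>B. (\<rho> v)\<^sup>2)
          + \<gamma> / \<sigma>\<^sup>2 * (\<Sum>v\<in>B. \<rho> v * (v \<bullet> \<mu>)\<^sup>2)) / (1 - 2 * \<gamma> * r)))"
proof -
  \<comment> \<open>Chosen so that the linearisation coefficient \<open>l\<^sup>2 / 2\<close> is
    \<open>\<gamma> / \<sigma>\<^sup>2\<close>; here \<open>\<sigma>\<close> must be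
    positive.\<close>
  define l where "l = sqrt (2 * \<gamma>) / \<sigma>"
  have l: "l\<^sup>2 / 2 = \<gamma> / \<sigma>\<^sup>2" "l\<^sup>2 * \<sigma>\<^sup>2 = 2 * \<gamma>"
    using \<sigma> \<gamma>(1) by (auto simp: l_def power_divide)
  have b: "2 * \<gamma> * \<rho> v \<le> 2 * \<gamma> * r" if "v \<in> B" for v
    using \<rho>(2)[OF that] \<gamma>(1) by simp
  have b1: "2 * \<gamma> * \<rho> v < 1" if "v \<in> B" for v
    using b[OF that] \<gamma>(2) by (rule order_le_less_trans)
  \<comment> \<open>The share of \<open>v\<close> in the final exponent.\<close>
  let ?e = "\<lambda>v. \<gamma> * \<rho> v + (\<gamma>\<^sup>2 * (\<rho> v)\<^sup>2 + \<gamma> / \<sigma>\<^sup>2 * (\<rho> v * (v \<bullet> \<mu>)\<^sup>2)) / (1 - 2 * \<gamma> * r)"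
  have factor: "exp (l\<^sup>2 * \<rho> v * (v \<bullet> \<mu>)\<^sup>2 / (2 * (1 - l\<^sup>2 * \<sigma>\<^sup>2 * \<rho> v)))
      / sqrt (1 - l\<^sup>2 * \<sigma>\<^sup>2 * \<rho> v) \<le> exp (?e v)" if v: "v \<in> B" for v
  proof -
    have nonneg: "0 \<le> \<gamma> * \<rho> v" using \<gamma>(1) \<rho>(1)[OF v] by simp
    have "1 / sqrt (1 - 2 * \<gamma> * \<rho> v)
        \<le> exp (\<gamma> * \<rho> v + (\<gamma> * \<rho> v)\<^sup>2 / (1 - 2 * \<gamma> * \<rho> v))"
      using inverse_sqrt_le_exp[of "\<gamma> * \<rho> v"] nonneg b1[OF v] by (simp add: mult.assoc)
    also have "\<dots> \<le> exp (\<gamma> * \<rho> v + (\<gamma> * \<rho> v)\<^sup>2 / (1 - 2 * \<gamma> * r))"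
      using b[OF v] b1[OF v] \<gamma>(2)
      by (intro exp_mono add_left_mono divide_left_mono mult_pos_pos) auto
    finally have "1 / sqrt (1 - 2 * \<gamma> * \<rho> v) \<le> \<dots>" .
    moreover have "\<gamma> / \<sigma>\<^sup>2 * (\<rho> v * (v \<bullet> \<mu>)\<^sup>2) / (1 - 2 * \<gamma> * \<rho> v)
        \<le> \<gamma> / \<sigma>\<^sup>2 * (\<rho> v * (v \<bullet> \<mu>)\<^sup>2) / (1 - 2 * \<gamma> * r)"
      using b[OF v] b1[OF v] \<gamma> \<rho>(1)[OF v] by (intro divide_left_mono mult_pos_pos) auto
    moreover have "l\<^sup>2 * \<rho> v * (v \<bullet> \<mu>)\<^sup>2 / (2 * (1 - l\<^sup>2 * \<sigma>\<^sup>2 * \<rho> v))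
        = \<gamma> / \<sigma>\<^sup>2 * (\<rho> v * (v \<bullet> \<mu>)\<^sup>2) / (1 - 2 * \<gamma> * \<rho> v)"
      unfolding l(2) l(1)[symmetric] by (simp add: mult.assoc)
    ultimately have "exp (l\<^sup>2 * \<rho> v * (v \<bullet> \<mu>)\<^sup>2 / (2 * (1 - l\<^sup>2 * \<sigma>\<^sup>2 * \<rho> v)))
        * (1 / sqrt (1 - 2 * \<gamma> * \<rho> v))
      \<le> exp (\<gamma> / \<sigma>\<^sup>2 * (\<rho> v * (v \<bullet> \<mu>)\<^sup>2) / (1 - 2 * \<gamma> * r))
        * exp (\<gamma> * \<rho> v + (\<gamma> * \<rho> v)\<^sup>2 / (1 - 2 * \<gamma> * r))"
      using b1[OF v] by (intro mult_mono) (auto simp: less_imp_le)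
    also have "\<dots> = exp (?e v)"
      by (simp add: power_mult_distrib add_divide_distrib flip: exp_add)
    finally show ?thesis by (simp add: l(2))
  qed
  have "(\<integral>\<^sup>+ \<omega>. ennreal (exp (\<gamma> / \<sigma>\<^sup>2 * (\<Sum>v\<in>B. \<rho> v * (v \<bullet> x \<omega>)\<^sup>2))) \<partial>M)
    \<le> ennreal (\<Prod>v\<in>B. exp (l\<^sup>2 * \<rho> v * (v \<bullet> \<mu>)\<^sup>2 / (2 * (1 - l\<^sup>2 * \<sigma>\<^sup>2 * \<rho> v)))
                    / sqrt (1 - l\<^sup>2 * \<sigma>\<^sup>2 * \<rho> v))"
    using b1 unfolding l(1)[symmetric]
    by (intro subgaussian_quadratic_form_mgf assms) (auto simp: l(2))
  also have "\<dots> \<le> ennreal (\<Prod>v\<in>B. exp (?e v))"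
    using factor b1
    by (intro ennreal_leI prod_mono conjI divide_nonneg_nonneg) (auto simp: l(2) less_imp_le)
  also have "(\<Prod>v\<in>B. exp (?e v)) = exp (\<Sum>v\<in>B. ?e v)" using B by (simp add: exp_sum)
  also have "(\<Sum>v\<in>B. ?e v) = \<gamma> * (\<Sum>v\<in>B. \<rho> v) + (\<gamma>\<^sup>2 * (\<Sum>v\<in>B. (\<rho> v)\<^sup>2)
          + \<gamma> / \<sigma>\<^sup>2 * (\<Sum>v\<in>B. \<rho> v * (v \<bullet> \<mu>)\<^sup>2)) / (1 - 2 * \<gamma> * r)"
    by (simp only: sum.distrib sum_distrib_left sum_divide_distrib add_divide_distrib)
  finally show ?thesis .
qed

subsection \<open>Tail bounds\<close>

text \<open>Chernoff's bound with parameter \<open>\<gamma> / \<sigma>\<^sup>2\<close>. The factor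
  \<open>1 + 2 * q\<close> is the closed form of the outer square root in the final bound, whose
  radicand is its square.\<close>

lemma subgaussian_quadratic_form_tail:
  fixes x :: "'a \<Rightarrow> 'b::euclidean_space" and B :: "'b set" and \<rho> :: "'b \<Rightarrow> real"
  assumes M: "prob_space M" and x[measurable]: "x \<in> borel_measurable M"
    and sub: "\<And>\<alpha>. (\<integral>\<^sup>+ \<omega>. ennreal (exp (\<alpha> \<bullet> (x \<omega> - \<mu>))) \<partial>M)
                 \<le> ennreal (exp ((norm \<alpha>)\<^sup>2 * \<sigma>\<^sup>2 / 2))"
    and B: "finite B" "pairwise orthogonal B" "\<And>v. v \<in> B \<Longrightarrow> norm v = 1"
    and \<rho>: "\<And>v. v \<in> B \<Longrightarrow> 0 \<le> \<rho> v" "\<And>v. v \<in> B \<Longrightarrow> \<rho> v \<le> r"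
    and \<sigma>: "0 < \<sigma>" and r: "0 \<le> r" and t: "0 < t"
    and T: "T = (\<Sum>v\<in>B. (\<rho> v)\<^sup>2)" "0 < T" and q: "q = r * sqrt (t / T)"
  shows "measure M {\<omega> \<in> space M. (\<Sum>v\<in>B. \<rho> v * (v \<bullet> x \<omega>)\<^sup>2) >
      \<sigma>\<^sup>2 * ((\<Sum>v\<in>B. \<rho> v) + 2 * sqrt (T * t) + 2 * r * t)
      + (\<Sum>v\<in>B. \<rho> v * (v \<bullet> \<mu>)\<^sup>2) * (1 + 2 * q)} \<le> exp (- t)"
proof -
  interpret prob_space M by fact
  define Q where "Q \<omega> = (\<Sum>v\<in>B. \<rho> v * (v \<bullet> x \<omega>)\<^sup>2)" for \<omega>
  define \<nu> where "\<nu> = (\<Sum>v\<in>B. \<rho> v * (v \<bullet> \<mu>)\<^sup>2)"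
  define E where "E = \<sigma>\<^sup>2 * ((\<Sum>v\<in>B. \<rho> v) + 2 * sqrt (T * t) + 2 * r * t) + \<nu> * (1 + 2 * q)"
  define \<gamma> where "\<gamma> = sqrt (t / T) / (1 + 2 * q)"
  have q0: "0 \<le> q" using r t T(2) q by simp
  have \<gamma>0: "0 < \<gamma>" using q0 t T(2) by (simp add: \<gamma>_def)
  \<comment> \<open>Division in the mgf bound thus becomes multiplication by
    \<open>1 + 2 * q\<close>, and the \<open>\<nu>\<close> terms cancel exactly against those of
    \<open>E\<close>.\<close>
  have \<gamma>r: "1 - 2 * \<gamma> * r = 1 / (1 + 2 * q)"
    using q0 by (simp add: \<gamma>_def q field_simps)
  then have \<gamma>r1: "2 * \<gamma> * r < 1" using q0 by (smt (verit) divide_pos_pos)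
  have [measurable]: "Q \<in> borel_measurable M" unfolding Q_def[abs_def] by measurable
  have mgf: "(\<integral>\<^sup>+ \<omega>. ennreal (exp (\<gamma> / \<sigma>\<^sup>2 * Q \<omega>)) \<partial>M)
    \<le> ennreal (exp (\<gamma> * (\<Sum>v\<in>B. \<rho> v) + (\<gamma>\<^sup>2 * T + \<gamma> / \<sigma>\<^sup>2 * \<nu>) * (1 + 2 * q)))"
    using subgaussian_quadratic_form_mgf_le[OF M x sub B \<rho> \<sigma> \<gamma>0 \<gamma>r1]
    unfolding Q_def \<nu>_def T(1) \<gamma>r by simp
  have "emeasure M {\<omega> \<in> space M. E < Q \<omega>} \<le> emeasure M {\<omega> \<in> space M. E \<le> Q \<omega>}"
    by (intro emeasure_mono) auto
  also have "\<dots> \<le> ennreal (exp (- (\<gamma> / \<sigma>\<^sup>2) * E)) *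
      (\<integral>\<^sup>+ \<omega>. ennreal (exp (\<gamma> / \<sigma>\<^sup>2 * Q \<omega>)) * indicator (space M) \<omega> \<partial>M)"
    by (rule Chernoff_ineq_nn_integral_ge) (use \<gamma>0 \<sigma> in auto)
  also have "(\<integral>\<^sup>+ \<omega>. ennreal (exp (\<gamma> / \<sigma>\<^sup>2 * Q \<omega>)) * indicator (space M) \<omega> \<partial>M)
      = (\<integral>\<^sup>+ \<omega>. ennreal (exp (\<gamma> / \<sigma>\<^sup>2 * Q \<omega>)) \<partial>M)"
    by (intro nn_integral_cong) auto
  also have "ennreal (exp (- (\<gamma> / \<sigma>\<^sup>2) * E)) * \<dots> \<le> ennreal (exp (- (\<gamma> / \<sigma>\<^sup>2) * E)) *
      ennreal (exp (\<gamma> * (\<Sum>v\<in>B. \<rho> v) + (\<gamma>\<^sup>2 * T + \<gamma> / \<sigma>\<^sup>2 * \<nu>) * (1 + 2 * q)))"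
    by (intro mult_left_mono mgf) simp
  also have "\<dots> = ennreal (exp (- t))"
  proof -
    have "T * t = t / T * T\<^sup>2" using T(2) by (simp add: power2_eq_square)
    then have s: "sqrt (T * t) = sqrt (t / T) * T"
      using T(2) by (simp only: real_sqrt_mult) simp
    have ss: "sqrt (t / T) * sqrt (t / T) = t / T" using T(2) t by simp
    \<comment> \<open>Once the trace and \<open>\<nu>\<close> terms cancel, only this gain and the
      cost \<open>\<gamma>\<^sup>2 * T * (1 + 2 * q)\<close> remain; their difference is
      \<open>t\<close>.\<close>
    have "\<gamma> * (2 * sqrt (T * t) + 2 * r * t) = 2 * t * (1 + q) / (1 + 2 * q)"
    proof -
      have "sqrt (t / T) * (2 * sqrt (T * t) + 2 * r * t) = 2 * (sqrt (t / T) * sqrt (t / T)) * T + 2 * q * t"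
        unfolding s q by (simp add: algebra_simps)
      also have "\<dots> = 2 * t * (1 + q)" unfolding ss using T(2) by (simp add: algebra_simps)
      finally show ?thesis by (simp add: \<gamma>_def)
    qed
    moreover have "\<gamma>\<^sup>2 * T * (1 + 2 * q) = t / (1 + 2 * q)"
      using q0 T(2) ss by (simp add: \<gamma>_def power2_eq_square)
    moreover have "2 * t * (1 + q) / (1 + 2 * q) - t / (1 + 2 * q) = t"
    proof -
      have "2 * t * (1 + q) - t = t * (1 + 2 * q)" by (simp add: algebra_simps)
      then show ?thesis using q0 by (simp flip: diff_divide_distrib)
    qed
    moreover have "\<gamma> / \<sigma>\<^sup>2 * E = \<gamma> * (\<Sum>v\<in>B. \<rho> v) + \<gamma> * (2 * sqrt (T * t) + 2 * r * t)
        + \<gamma> / \<sigma>\<^sup>2 * \<nu> * (1 + 2 * q)"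
      using \<sigma> by (simp add: E_def field_simps)
    ultimately have "- (\<gamma> / \<sigma>\<^sup>2) * E + (\<gamma> * (\<Sum>v\<in>B. \<rho> v)
        + (\<gamma>\<^sup>2 * T + \<gamma> / \<sigma>\<^sup>2 * \<nu>) * (1 + 2 * q)) = - t"
      by (simp add: distrib_right)
    then show ?thesis by (simp flip: ennreal_mult exp_add)
  qed
  finally have "measure M {\<omega> \<in> space M. E < Q \<omega>} \<le> exp (- t)"
    by (simp add: emeasure_eq_measure)
  then show ?thesis by (simp add: E_def \<nu>_def Q_def)
qed

text \<open>Translation of the eigenvalue bound back to \<open>A\<close>. For \<open>T > 0\<close>
  the radicand is a perfect square; \<open>T = 0\<close> is handled apart.\<close>

lemma subgaussian_norm_tail_pos:
  fixes A :: "real ^ 'n ^ 'm" and x :: "'a \<Rightarrow> real ^ 'n"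
  assumes M: "prob_space M" and x: "x \<in> borel_measurable M"
    and S: "S = transpose A ** A" and \<sigma>: "0 < \<sigma>"
    and int: "\<And>\<alpha>. integrable M (\<lambda>\<omega>. exp (\<alpha> \<bullet> (x \<omega> - \<mu>)))"
    and sub: "\<And>\<alpha>. (\<integral>\<omega>. exp (\<alpha> \<bullet> (x \<omega> - \<mu>)) \<partial>M) \<le> exp ((norm \<alpha>)\<^sup>2 * \<sigma>\<^sup>2 / 2)"
    and t: "0 < t"
  defines "r \<equiv> onorm ((*v) S)" and "T \<equiv> trace (S ** S)"
  shows "measure M {\<omega> \<in> space M. (norm (A *v x \<omega>))\<^sup>2 >
      \<sigma>\<^sup>2 * (trace S + 2 * sqrt (T * t) + 2 * r * t)
      + (norm (A *v \<mu>))\<^sup>2 * sqrt (1 + 4 * sqrt (r\<^sup>2 / T * t) + 4 * r\<^sup>2 / T * t)} \<le> exp (- t)"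
proof -
  interpret prob_space M by fact
  obtain B :: "(real ^ 'n) set" and \<rho> where
    B: "finite B" "pairwise orthogonal B" "\<And>v. v \<in> B \<Longrightarrow> norm v = 1"
    and \<rho>: "\<And>v. v \<in> B \<Longrightarrow> 0 \<le> \<rho> v" "\<And>v. v \<in> B \<Longrightarrow> \<rho> v \<le> r"
    and trS: "trace S = (\<Sum>v\<in>B. \<rho> v)" and T: "T = (\<Sum>v\<in>B. (\<rho> v)\<^sup>2)"
    and norm_A: "\<And>x. (norm (A *v x))\<^sup>2 = (\<Sum>v\<in>B. \<rho> v * (v \<bullet> x)\<^sup>2)"
    by (rule gram_matrix_spectral[of A, folded S, folded r_def T_def], rule that) assumption+
  have r: "0 \<le> r" unfolding r_def by (rule onorm_pos_le) (rule matrix_vector_mul_bounded_linear)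
  have "0 \<le> T" unfolding T by (intro sum_nonneg) simp
  show ?thesis
  proof (cases "T = 0")
    \<comment> \<open>\<open>T = 0\<close> forces \<open>A = 0\<close>, so the event is empty whatever the junk value of \<open>r\<^sup>2 / T\<close>.\<close>
    case True
    then have "\<forall>v\<in>B. \<rho> v = 0" using B unfolding T by (simp add: sum_nonneg_eq_0_iff)
    then have zero: "(norm (A *v z))\<^sup>2 = 0" "trace S = 0" for z by (simp_all add: norm_A trS)
    show ?thesis using r t unfolding zero True by (simp add: mult_less_0_iff)
  next
    case False
    then have "0 < T" using \<open>0 \<le> T\<close> by simp
    define q where "q = r * sqrt (t / T)"
    have q2: "r\<^sup>2 / T * t = q\<^sup>2" using t \<open>0 < T\<close> by (simp add: q_def power_mult_distrib)
    then have "4 * r\<^sup>2 / T * t = 4 * q\<^sup>2" by simp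
    moreover have "0 \<le> q" using r t \<open>0 < T\<close> by (simp add: q_def)
    ultimately have "1 + 4 * sqrt (r\<^sup>2 / T * t) + 4 * r\<^sup>2 / T * t = (1 + 2 * q)\<^sup>2"
      unfolding q2 by (simp add: power2_sum power_mult_distrib)
    then have root: "sqrt (1 + 4 * sqrt (r\<^sup>2 / T * t) + 4 * r\<^sup>2 / T * t) = 1 + 2 * q"
      using \<open>0 \<le> q\<close> by simp
    \<comment> \<open>Integrability makes the Bochner expectation agree with the nonnegative
      integral used above.\<close>
    have "(\<integral>\<^sup>+ \<omega>. ennreal (exp (\<alpha> \<bullet> (x \<omega> - \<mu>))) \<partial>M)
        \<le> ennreal (exp ((norm \<alpha>)\<^sup>2 * \<sigma>\<^sup>2 / 2))" for \<alpha>
      using sub[of \<alpha>] int[of \<alpha>] by (subst nn_integral_eq_integral) (auto intro: ennreal_leI)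
    from subgaussian_quadratic_form_tail[OF M x this B \<rho> \<sigma> r t T \<open>0 < T\<close> q_def]
    show ?thesis unfolding root norm_A trS .
  qed
qed

theorem theorem1:
  fixes M :: "'a measure"
    and A :: "real ^ 'n ^ 'm"
    and \<Sigma> :: "real ^ 'n ^ 'n"
    and x :: "'a \<Rightarrow> real ^ 'n"
    and \<mu> :: "real ^ 'n"
    and \<sigma> t :: real
  assumes "prob_space M"
    and "x \<in> borel_measurable M"
    and "\<Sigma> = transpose A ** A"
    and "\<sigma> \<ge> 0"
    and "\<And>\<alpha>. integrable M (\<lambda>\<omega>. exp (\<alpha> \<bullet> (x \<omega> - \<mu>)))"
    and "\<And>\<alpha>. (\<integral>\<omega>. exp (\<alpha> \<bullet> (x \<omega> - \<mu>)) \<partial>M) \<le> exp ((norm \<alpha>)\<^sup>2 * \<sigma>\<^sup>2 / 2)"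
    and "t > 0"
  shows "measure M {\<omega> \<in> space M.
      (norm (A *v x \<omega>))\<^sup>2 >
        \<sigma>\<^sup>2 * (trace \<Sigma> + 2 * sqrt (trace (\<Sigma> ** \<Sigma>) * t) + 2 * onorm (\<lambda>v. \<Sigma> *v v) * t)
        + (norm (A *v \<mu>))\<^sup>2 *
            sqrt (1 + 4 * sqrt ((onorm (\<lambda>v. \<Sigma> *v v))\<^sup>2 / trace (\<Sigma> ** \<Sigma>) * t)
                    + 4 * (onorm (\<lambda>v. \<Sigma> *v v))\<^sup>2 / trace (\<Sigma> ** \<Sigma>) * t)}
    \<le> exp (- t)"
proof (cases "\<sigma> = 0")
  case False
  then show ?thesis using assms by (intro subgaussian_norm_tail_pos) auto
next
  case True
  interpret prob_space M by fact
  note [measurable] = \<open>x \<in> borel_measurable M\<close>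
  define K where "K = trace \<Sigma> + 2 * sqrt (trace (\<Sigma> ** \<Sigma>) * t) + 2 * onorm (\<lambda>v. \<Sigma> *v v) * t"
  define C where "C = (norm (A *v \<mu>))\<^sup>2 *
            sqrt (1 + 4 * sqrt ((onorm (\<lambda>v. \<Sigma> *v v))\<^sup>2 / trace (\<Sigma> ** \<Sigma>) * t)
                    + 4 * (onorm (\<lambda>v. \<Sigma> *v v))\<^sup>2 / trace (\<Sigma> ** \<Sigma>) * t)"
  \<comment> \<open>Positive parameters tending to 0. The hypothesis for \<open>\<sigma> = 0\<close>
    bounds the expectation by 1, so it implies the one for every \<open>s n\<close>.\<close>
  define s where "s n = 1 / real (Suc n)" for n
  define E where "E n = {\<omega> \<in> space M. (norm (A *v x \<omega>))\<^sup>2 > (s n)\<^sup>2 * K + C}" for n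
  have [measurable]: "(\<lambda>\<omega>. A *v x \<omega>) \<in> borel_measurable M"
    by (rule measurable_compose[OF \<open>x \<in> borel_measurable M\<close>])
      (intro borel_measurable_continuous_onI linear_continuous_on matrix_vector_mul_bounded_linear)
  \<comment> \<open>With this sign the thresholds \<open>(s n)\<^sup>2 * K + C\<close> decrease in
    \<open>n\<close>, so the events \<open>E n\<close> increase.\<close>
  have "0 \<le> K"
  proof -
    obtain B :: "(real ^ 'n) set" and \<rho> where "\<And>v. v \<in> B \<Longrightarrow> 0 \<le> \<rho> v"
      "trace \<Sigma> = (\<Sum>v\<in>B. \<rho> v)" "trace (\<Sigma> ** \<Sigma>) = (\<Sum>v\<in>B. (\<rho> v)\<^sup>2)"
      by (rule gram_matrix_spectral[of A, folded assms(3)], rule that) assumption+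
    moreover have "0 \<le> onorm ((*v) \<Sigma>)"
      by (rule onorm_pos_le) (rule matrix_vector_mul_bounded_linear)
    ultimately show ?thesis using \<open>t > 0\<close> by (simp add: K_def sum_nonneg)
  qed
  have bound: "measure M (E n) \<le> exp (- t)" for n
  proof -
    have "(\<integral>\<omega>. exp (\<alpha> \<bullet> (x \<omega> - \<mu>)) \<partial>M) \<le> exp ((norm \<alpha>)\<^sup>2 * (s n)\<^sup>2 / 2)" for \<alpha>
      using assms(6)[of \<alpha>] by (rule order_trans) (simp add: True)
    then show ?thesis unfolding E_def K_def C_def
      using assms by (intro subgaussian_norm_tail_pos) (auto simp: s_def)
  qed
  have "incseq E"
  proof (rule incseq_SucI)
    fix n
    have "(s (Suc n))\<^sup>2 \<le> (s n)\<^sup>2" by (intro power_mono) (auto simp: s_def field_simps)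
    then have "(s (Suc n))\<^sup>2 * K \<le> (s n)\<^sup>2 * K" using \<open>0 \<le> K\<close> by (rule mult_right_mono)
    then show "E n \<subseteq> E (Suc n)" by (auto simp: E_def)
  qed
  moreover have "range E \<subseteq> sets M" by (auto simp: E_def)
  ultimately have "(\<lambda>n. measure M (E n)) \<longlonglongrightarrow> measure M (\<Union>n. E n)"
    by (intro finite_Lim_measure_incseq)
  then have "measure M (\<Union>n. E n) \<le> exp (- t)"
    using bound by (intro LIMSEQ_le_const2) auto
  \<comment> \<open>The strict inequality matters: a value above \<open>C\<close> already exceeds
    some threshold, since these tend to \<open>C\<close> from above.\<close>
  moreover have "(\<Union>n. E n) = {\<omega> \<in> space M. (norm (A *v x \<omega>))\<^sup>2 > C}"
  proof -
    have "s \<longlonglongrightarrow> 0" unfolding s_def[abs_def] by (rule LIMSEQ_Suc[OF lim_const_over_n])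
    then have lim: "(\<lambda>n. (s n)\<^sup>2 * K + C) \<longlonglongrightarrow> C" by (auto intro!: tendsto_eq_intros)
    have "\<exists>n. (s n)\<^sup>2 * K + C < y" if "C < y" for y
      using order_tendstoD(2)[OF lim that] eventually_happens'[OF sequentially_bot] by blast
    moreover have "C < y" if "(s n)\<^sup>2 * K + C < y" for n y
    proof -
      have "0 \<le> (s n)\<^sup>2 * K" using \<open>0 \<le> K\<close> by simp
      then show ?thesis using that by linarith
    qed
    ultimately show ?thesis unfolding E_def by blast
  qed
  ultimately show ?thesis by (simp add: True C_def)
qed

end
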